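(* Let $c\in[0,1)$. There exists a deterministic and strategyproof mechanism $f$ for the weighted facility location problem with predictions in $\mathbb{R}^2$ such that for every $n\ge 1$, every profile $P=(p_1,\dots,p_n)\in(\mathbb{R}^2)^n$ and every choice of weights $w_1,\dots,w_n>0$, writing $W_{\min}=\min_i w_i$ and $W_{\max}=\max_i w_i$: (i) (consistency) $C^u(f(P,o(P)),P)\le \frac{\sqrt{(1+c)^2W_{\min}^2+(1-c)^2W_{\max}^2}}{(1+c)W_{\min}}\; C^u(o(P),P)$; (ii) (robustness) for every prediction $\hat o\in\mathbb{R}^2$, $C^u(f(P,\hat o),P)\le \frac{\sqrt{(1-c)^2W_{\min}^2+(1+c)^2W_{\max}^2}}{(1-c)W_{\min}}\; C^u(o(P),P)$.
   Context: Weighted facility location with predictions: there are $n$ agents; agent $i$ has a private preferred location $p_i\in\mathbb{R}^2$ and a public weight $w_i>0$; $d$ is Euclidean distance. For a facility location $f\in\mathbb{R}^2$, the utilitarian cost is $C^u(f,P)=\frac1n\sum_{i=1}^n w_i\, d(f,p_i)$, and $o(P)$ denotes an optimal location, i.e. a minimizer of $C^u(\cdot,P)$. A (deterministic) mechanism is a map $f$ that takes the reported locations $(\hat p_1,\dots,\hat p_n)$, the (public) weights and a prediction $\hat o\in\mathbb{R}^2$ of the optimal location, and outputs a facility location $f(P,\hat o)\in\mathbb{R}^2$. Agent $i$'s individual cost is $w_i\, d(f,p_i)$. The mechanism is strategyproof if for every profile $P$, weights, prediction $\hat o$, agent $i$ and misreport $p_i'\in\mathbb{R}^2$, $d(f(P,\hat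 o),p_i)\le d(f((P_{-i},p_i'),\hat o),p_i)$, where $(P_{-i},p_i')$ is $P$ with $p_i$ replaced by $p_i'$. *)

theory Defs
  imports "HOL-Analysis.Analysis"
begin

text \<open>
  A profile of \<open>n\<close> agents is a list of \<open>n\<close> points of the plane, accompanied by a list of \<open>n\<close>
  weights; agents are numbered \<open>0, \<dots>, n - 1\<close>. The distance on \<^typ>\<open>real ^ 2\<close> is Euclidean.
\<close>

type_synonym point = "real ^ 2"

definition util_cost :: "real list \<Rightarrow> point \<Rightarrow> point list \<Rightarrow> real" where
  "util_cost w x P = (1 / real (length P)) * (\<Sum>i<length P. w ! i * dist x (P ! i))"

definition optimal_location :: "real list \<Rightarrow> point list \<Rightarrow> point \<Rightarrow> bool" where
  "optimal_location w P x \<longleftrightarrow> (\<forall>y. util_cost w x P \<le> util_cost w y P)"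

text \<open>
  A mechanism receives the reported locations, the public weights and the prediction. A single
  mechanism handles every number of agents.
\<close>

type_synonym mechanism = "point list \<Rightarrow> real list \<Rightarrow> point \<Rightarrow> point"

definition weighted_instance :: "nat \<Rightarrow> point list \<Rightarrow> real list \<Rightarrow> bool" where
  "weighted_instance n P w \<longleftrightarrow> length P = n \<and> length w = n \<and> (\<forall>i<n. 0 < w ! i)"

text \<open>
  The individual cost of agent \<open>i\<close> is the positive factor \<open>w ! i\<close> times its distance to the
  facility, so the weight is omitted on both sides.
\<close>

definition strategyproof :: "mechanism \<Rightarrow> bool" where
  "strategyproof f \<longleftrightarrow>
     (\<forall>n P w pred i p'. weighted_instance n P w \<longrightarrow> i < n \<longrightarrow>
        dist (f P w pred) (P ! i) \<le> dist (f (P[i := p']) w pred) (P ! i))"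

text \<open>Optimal locations exist; they need not be unique when the agents are collinear.\<close>

lemma optimal_location_exists:
  assumes "weighted_instance n P w" "n \<ge> 1"
  shows "\<exists>x. optimal_location w P x"
proof -
  have len: "length P = n" and w0: "\<And>i. i < n \<Longrightarrow> 0 < w ! i"
    using assms(1) by (auto simp: weighted_instance_def)
  define p where "p = P ! 0"
  define R where "R = real n * util_cost w p P / w ! 0"
  have pos: "0 < w ! 0" using w0 assms(2) by simp
  have "0 \<le> util_cost w p P"
    unfolding util_cost_def len using w0
    by (intro mult_nonneg_nonneg sum_nonneg) (auto intro: less_imp_le)
  then have R: "0 \<le> R" using pos by (simp add: R_def)
  have "continuous_on (cball p R) (\<lambda>x. util_cost w x P)"
    unfolding util_cost_def by (intro continuous_intros)
  then obtain x where x: "x \<in> cball p R"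
    and min: "\<And>y. y \<in> cball p R \<Longrightarrow> util_cost w x P \<le> util_cost w y P"
    using continuous_attains_inf[of "cball p R" "\<lambda>x. util_cost w x P"] R by auto
  have "util_cost w x P \<le> util_cost w y P" for y
  proof (cases "y \<in> cball p R")
    case True
    then show ?thesis by (rule min)
  next
    case False
    then have "R < dist y p" by (simp add: dist_commute)
    then have "real n * util_cost w p P < w ! 0 * dist y p"
      using pos by (simp add: R_def field_simps)
    also have "\<dots> \<le> (\<Sum>i<n. w ! i * dist y (P ! i))"
      unfolding p_def using assms(2) w0
      by (intro member_le_sum[where f = "\<lambda>i. w ! i * dist y (P ! i)"])
         (auto intro!: mult_nonneg_nonneg less_imp_le[OF w0])
    also have "\<dots> = real n * util_cost w y P"
      using assms(2) by (simp add: util_cost_def len)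
    finally have "util_cost w p P < util_cost w y P"
      using assms(2) by simp
    moreover have "util_cost w x P \<le> util_cost w p P" using R by (intro min) simp
    ultimately show ?thesis by simp
  qed
  then show ?thesis by (auto simp: optimal_location_def)
qed

end

theory Submission
  imports Defs
begin

text \<open>
  The mechanism takes in each coordinate a weighted median of the reports and of the prediction,
  the latter with weight \<open>c * W\<close>, where \<open>W\<close> is the total weight of the agents. In each coordinate
  a misreport can move the facility only away from the true position, which gives
  strategyproofness.

  For the cost put the facility at the origin and let the competing location be \<open>(a, b)\<close> with
  \<open>a, b \<ge> 0\<close>. The median property bounds the share of the weight in each of the open half planes
  \<open>x > 0\<close> and \<open>y > 0\<close> by \<open>k / (1 + k)\<close>, where \<open>k = (1 + c) / (1 - c)\<close> in general and
  \<open>k = (1 - c) / (1 + c)\<close> if \<open>(a, b)\<close> is the prediction (there the bound may fail for a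
  coordinate with \<open>a = 0\<close> or \<open>b = 0\<close>, but its multiplier is then \<open>0\<close>). Hence it suffices to find
  multipliers \<open>m, n \<ge> 0\<close> of these two linear constraints such that, for every point \<open>p = (x, y)\<close>,
  \<open>|p| \<le> sqrt (1 + k\<^sup>2) * |p - (a, b)| + m * h x + n * h y\<close>, where \<open>h\<close> is \<open>1\<close> on positive and \<open>- k\<close>
  on other numbers; this is a Cauchy-Schwarz estimate in each quadrant. The resulting factor
  \<open>sqrt (1 + k\<^sup>2)\<close> is at most the claimed one because \<open>W\<^sub>m\<^sub>i\<^sub>n \<le> W\<^sub>m\<^sub>a\<^sub>x\<close>.
\<close>

section \<open>Weighted medians\<close>

definition mass :: "real list \<Rightarrow> real list \<Rightarrow> (real \<Rightarrow> bool) \<Rightarrow> real" where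
  "mass xs w Q = (\<Sum>i<length xs. if Q (xs ! i) then w ! i else 0)"

lemma mass_Cons: "mass (x # xs) (v # w) Q = (if Q x then v else 0) + mass xs w Q"
  by (simp add: mass_def sum.lessThan_Suc_shift cong: if_cong del: sum.lessThan_Suc)

lemma mass_cong: "(\<And>x. x \<in> set xs \<Longrightarrow> Q x = R x) \<Longrightarrow> mass xs w Q = mass xs w R"
  unfolding mass_def by (intro sum.cong) auto

lemma mass_compl: "mass xs w Q + mass xs w (\<lambda>x. \<not> Q x) = (\<Sum>i<length xs. w ! i)"
  unfolding mass_def sum.distrib[symmetric] by (intro sum.cong) auto

lemma mass_mono:
  assumes "\<And>i. i < length xs \<Longrightarrow> 0 \<le> w ! i" "\<And>x. x \<in> set xs \<Longrightarrow> Q x \<Longrightarrow> R x"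
  shows "mass xs w Q \<le> mass xs w R"
  unfolding mass_def using assms by (intro sum_mono) auto

lemma mass_update_le:
  assumes "\<And>j. j < length xs \<Longrightarrow> 0 \<le> w ! j" "Q x' \<Longrightarrow> Q (xs ! i)"
  shows "mass (xs[i := x']) w Q \<le> mass xs w Q"
proof -
  have "(if Q (xs[i := x'] ! j) then w ! j else 0) \<le> (if Q (xs ! j) then w ! j else 0)"
    if "j < length xs" for j
    using assms that by (cases "j = i") auto
  then show ?thesis unfolding mass_def length_list_update by (intro sum_mono) auto
qed

text \<open>The equivalence singles out the least threshold at which the cumulative weight reaches
  half the total, the lower weighted median. It determines \<open>m\<close> uniquely, so ties need
  no further rule.\<close>

definition is_wmedian :: "real list \<Rightarrow> real list \<Rightarrow> real \<Rightarrow> bool" where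
  "is_wmedian xs w m \<longleftrightarrow>
     (\<forall>z. (\<Sum>i<length xs. w ! i) / 2 \<le> mass xs w (\<lambda>x. x \<le> z) \<longleftrightarrow> m \<le> z)"

definition wmedian :: "real list \<Rightarrow> real list \<Rightarrow> real" where
  "wmedian xs w = (SOME m. is_wmedian xs w m)"

lemma is_wmedian_wmedian:
  assumes w: "\<And>i. i < length xs \<Longrightarrow> 0 \<le> w ! i" and pos: "0 < (\<Sum>i<length xs. w ! i)"
  shows "is_wmedian xs w (wmedian xs w)"
proof -
  let ?T = "(\<Sum>i<length xs. w ! i) / 2"
  let ?F = "\<lambda>z. mass xs w (\<lambda>x. x \<le> z)"
  define Z where "Z = {z \<in> set xs. ?T \<le> ?F z}"
  \<comment> \<open>Lowering a threshold to the largest entry not exceeding it keeps the cumulative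
    weight, so the minimum is attained among the finitely many entries. A positive total excludes
    thresholds below every entry.\<close>
  have below: "\<exists>z'\<in>Z. z' \<le> z" if z: "?T \<le> ?F z" for z
  proof -
    let ?B = "{x \<in> set xs. x \<le> z}"
    have "?B \<noteq> {}"
    proof
      assume "?B = {}"
      then have "?F z = mass xs w (\<lambda>x. False)" by (intro mass_cong) auto
      then show False using z pos by (simp add: mass_def)
    qed
    then have mem: "Max ?B \<in> ?B" by (intro Max_in) auto
    have "x \<le> Max ?B \<longleftrightarrow> x \<le> z" if "x \<in> set xs" for x
      using mem that by (auto intro!: Max_ge)
    then have "?F (Max ?B) = ?F z" by (intro mass_cong) auto
    then show ?thesis using mem z by (auto simp: Z_def)
  qed
  have ne: "xs \<noteq> []" using pos by auto
  have "?F (Max (set xs)) = mass xs w (\<lambda>x. True)" by (intro mass_cong) auto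
  then have "?T \<le> ?F (Max (set xs))" using pos by (simp add: mass_def)
  with below have "Z \<noteq> {}" by blast
  moreover have "finite Z" by (simp add: Z_def)
  ultimately have mZ: "Min Z \<in> Z" and le: "\<And>z. z \<in> Z \<Longrightarrow> Min Z \<le> z" by auto
  have "?T \<le> ?F z \<longleftrightarrow> Min Z \<le> z" for z
  proof
    assume "Min Z \<le> z"
    then have "?F (Min Z) \<le> ?F z" using w by (intro mass_mono) auto
    then show "?T \<le> ?F z" using mZ by (simp add: Z_def)
  qed (use below le in fastforce)
  then have "is_wmedian xs w (Min Z)" by (simp add: is_wmedian_def)
  then show ?thesis unfolding wmedian_def by (rule someI)
qed

lemma is_wmedian_above:
  assumes "is_wmedian xs w m"
  shows "mass xs w (\<lambda>x. x > m) \<le> (\<Sum>i<length xs. w ! i) / 2"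
proof -
  have "(\<Sum>i<length xs. w ! i) / 2 \<le> mass xs w (\<lambda>x. x \<le> m)"
    using assms by (auto simp: is_wmedian_def)
  then show ?thesis using mass_compl[of xs w "\<lambda>x. x \<le> m"] by (simp add: not_le)
qed

lemma is_wmedian_below:
  assumes "is_wmedian xs w m"
  shows "mass xs w (\<lambda>x. x < m) \<le> (\<Sum>i<length xs. w ! i) / 2"
proof -
  \<comment> \<open>The extra element \<open>m - 1\<close> keeps the set nonempty when no entry lies
    below \<open>m\<close>. Half the total is not reached at \<open>Max B\<close>, which is less
    than \<open>m\<close>.\<close>
  define B where "B = insert (m - 1) {x \<in> set xs. x < m}"
  have B: "finite B" "B \<noteq> {}" by (auto simp: B_def)
  then have "Max B \<in> B" by (intro Max_in)
  then have "Max B < m" by (auto simp: B_def)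
  moreover have "x < m \<longleftrightarrow> x \<le> Max B" if "x \<in> set xs" for x
  proof
    assume "x < m"
    then show "x \<le> Max B" using B(1) that by (intro Max_ge) (auto simp: B_def)
  qed (use \<open>Max B < m\<close> in linarith)
  then have "mass xs w (\<lambda>x. x < m) = mass xs w (\<lambda>x. x \<le> Max B)"
    by (intro mass_cong) auto
  ultimately show ?thesis using assms unfolding is_wmedian_def
    by (metis linorder_not_le nless_le)
qed

lemma is_wmedian_side:
  assumes "is_wmedian xs w m" "s \<in> {1, -1}"
  shows "mass xs w (\<lambda>x. s * (x - m) > 0) \<le> (\<Sum>i<length xs. w ! i) / 2"
  using assms(2) is_wmedian_above[OF assms(1)] is_wmedian_below[OF assms(1)]
  by (auto simp: algebra_simps)

text \<open>A misreport cannot raise the cumulative weight at thresholds at or above the true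
  position, nor lower it at thresholds below. So the median cannot be pulled towards the true
  position from either side.\<close>

lemma is_wmedian_strategyproof:
  assumes w: "\<And>j. j < length xs \<Longrightarrow> 0 \<le> w ! j"
    and m: "is_wmedian xs w m" and m': "is_wmedian (xs[i := x']) w m'"
  shows "\<bar>m - xs ! i\<bar> \<le> \<bar>m' - xs ! i\<bar>"
proof -
  let ?T = "(\<Sum>j<length xs. w ! j) / 2" and ?ys = "xs[i := x']"
  have M: "?T \<le> mass xs w (\<lambda>x. x \<le> z) \<longleftrightarrow> m \<le> z"
    and M': "?T \<le> mass ?ys w (\<lambda>x. x \<le> z) \<longleftrightarrow> m' \<le> z" for z
    using m m' by (auto simp: is_wmedian_def)
  consider "xs ! i = m" | "xs ! i < m" | "m < xs ! i" by linarith
  then show ?thesis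
  proof cases
    case 2
    have "m \<le> m'"
    proof (rule ccontr)
      assume "\<not> m \<le> m'"
      \<comment> \<open>At or above \<open>m'\<close>, the modified list reaches half; at or above
        \<open>xs ! i\<close>, the true report is already counted. Both bounds lie below
        \<open>m\<close>.\<close>
      define z where "z = max m' (xs ! i)"
      have "mass ?ys w (\<lambda>x. x \<le> z) \<le> mass xs w (\<lambda>x. x \<le> z)"
        using w by (intro mass_update_le) (auto simp: z_def)
      moreover have "?T \<le> mass ?ys w (\<lambda>x. x \<le> z)" unfolding M' by (simp add: z_def)
      ultimately have "m \<le> z" using M[of z] by linarith
      then show False using 2 \<open>\<not> m \<le> m'\<close> by (simp add: z_def)
    qed
    then show ?thesis using 2 by linarith
  next
    case 3
    \<comment> \<open>The truthful list is viewed as a change of the misreported one, since the true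
      report is not counted at \<open>m\<close>.\<close>
    have "mass (?ys[i := xs ! i]) w (\<lambda>x. x \<le> m) \<le> mass ?ys w (\<lambda>x. x \<le> m)"
      using w 3 by (intro mass_update_le) auto
    then have "mass xs w (\<lambda>x. x \<le> m) \<le> mass ?ys w (\<lambda>x. x \<le> m)" by simp
    then have "m' \<le> m" using M[of m] M'[of m] by linarith
    then show ?thesis using 3 by linarith
  qed simp
qed

section \<open>The mechanism\<close>

definition median_mechanism :: "real \<Rightarrow> mechanism" where
  "median_mechanism c P w pred =
     (\<chi> j. wmedian (pred $ j # map (\<lambda>p. p $ j) P) (c * (\<Sum>i<length P. w ! i) # w))"

lemma weighted_instance_sum_pos:
  assumes "weighted_instance n P w" "n \<ge> 1"
  shows "0 < (\<Sum>i<n. w ! i)"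
  using assms by (intro sum_pos) (auto simp: weighted_instance_def lessThan_empty_iff)

lemma nth_nonneg_Cons:
  assumes "weighted_instance n P w" "n \<ge> 1" "0 \<le> c" "i < Suc n"
  shows "0 \<le> (c * (\<Sum>i<n. w ! i) # w) ! i"
  using assms weighted_instance_sum_pos[OF assms(1,2)]
  by (cases i) (auto simp: weighted_instance_def intro: less_imp_le)

lemma median_mechanism_median:
  assumes "weighted_instance n P w" "n \<ge> 1" "0 \<le> c"
  shows "is_wmedian (pred $ j # map (\<lambda>p. p $ j) P) (c * (\<Sum>i<n. w ! i) # w)
    (median_mechanism c P w pred $ j)"
proof -
  have len: "length P = n" using assms by (simp add: weighted_instance_def)
  have "0 < (\<Sum>i<Suc n. (c * (\<Sum>i<n. w ! i) # w) ! i)"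
    using weighted_instance_sum_pos[OF assms(1,2)] assms(3)
    by (simp add: sum.lessThan_Suc_shift add_nonneg_pos del: sum.lessThan_Suc)
  then show ?thesis using nth_nonneg_Cons[OF assms] unfolding median_mechanism_def len
    by (simp only: vec_lambda_beta, intro is_wmedian_wmedian)
      (auto simp: len simp del: sum.lessThan_Suc)
qed

lemma strategyproof_median_mechanism:
  assumes "0 \<le> c"
  shows "strategyproof (median_mechanism c)"
  unfolding strategyproof_def
proof (intro allI impI)
  fix n P w pred i p'
  assume inst: "weighted_instance n P w" and i: "i < n"
  then have n: "n \<ge> 1" and len: "length P = n" by (auto simp: weighted_instance_def)
  have inst': "weighted_instance n (P[i := p']) w"
    using inst by (simp add: weighted_instance_def)
  have "\<bar>median_mechanism c P w pred $ j - P ! i $ j\<bar>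
      \<le> \<bar>median_mechanism c (P[i := p']) w pred $ j - P ! i $ j\<bar>" for j
  proof -
    let ?xs = "pred $ j # map (\<lambda>p. p $ j) P"
    \<comment> \<open>The prediction occupies index 0, so agent \<open>i\<close> sits at
      \<open>Suc i\<close>.\<close>
    have eq: "pred $ j # map (\<lambda>p. p $ j) (P[i := p']) = ?xs[Suc i := p' $ j]"
      by (simp add: map_update)
    have "\<bar>median_mechanism c P w pred $ j - ?xs ! Suc i\<bar>
        \<le> \<bar>median_mechanism c (P[i := p']) w pred $ j - ?xs ! Suc i\<bar>"
      using nth_nonneg_Cons[OF inst n assms] len
      by (intro is_wmedian_strategyproof[OF _ median_mechanism_median[OF inst n assms]
            median_mechanism_median[OF inst' n assms, of pred j, unfolded eq]]) simp
    then show ?thesis using i by (simp add: len)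
  qed
  then show "dist (median_mechanism c P w pred) (P ! i)
      \<le> dist (median_mechanism c (P[i := p']) w pred) (P ! i)"
    unfolding dist_vec_def by (intro L2_set_mono) (auto simp: dist_real_def)
qed

section \<open>Shares of weight on either side of the facility\<close>

definition side :: "real \<Rightarrow> real \<Rightarrow> real" where
  "side k s = (if s > 0 then 1 else - k)"

text \<open>The sum is \<open>1 + k\<close> times the weight on the positive side minus
  \<open>k\<close> times the total, and \<open>r\<close> is the share
  \<open>k / (1 + k)\<close>.\<close>

lemma sum_side_le_0:
  fixes s :: real
  assumes k: "k \<ge> 0" "(1 + k) * r = k"
    and mass: "mass xs w (\<lambda>x. s * (x - m) > 0) \<le> r * (\<Sum>i<length xs. w ! i)"
  shows "(\<Sum>i<length xs. w ! i * side k (s * (xs ! i - m))) \<le> 0"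
proof -
  have "(\<Sum>i<length xs. w ! i * side k (s * (xs ! i - m)))
      = (\<Sum>i<length xs. (1 + k) * (if s * (xs ! i - m) > 0 then w ! i else 0) - k * w ! i)"
    by (intro sum.cong) (auto simp: side_def algebra_simps)
  also have "\<dots> = (1 + k) * mass xs w (\<lambda>x. s * (x - m) > 0) - k * (\<Sum>i<length xs. w ! i)"
    by (simp add: sum_subtractf sum_distrib_left mass_def)
  also have "\<dots> \<le> (1 + k) * (r * (\<Sum>i<length xs. w ! i)) - k * (\<Sum>i<length xs. w ! i)"
    using k mass by (intro diff_right_mono mult_left_mono) auto
  also have "\<dots> = 0" unfolding mult.assoc[symmetric] k(2) by simp
  finally show ?thesis .
qed

lemma median_mechanism_mass:
  assumes inst: "weighted_instance n P w" and n: "n \<ge> 1" and c: "0 \<le> c" and s: "s \<in> {1, -1}"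
  shows "(if s * (pred $ j - median_mechanism c P w pred $ j) > 0 then c * (\<Sum>i<n. w ! i) else 0)
      + mass (map (\<lambda>p. p $ j) P) w (\<lambda>x. s * (x - median_mechanism c P w pred $ j) > 0)
    \<le> (1 + c) * (\<Sum>i<n. w ! i) / 2"
  using is_wmedian_side[OF median_mechanism_median[OF inst n c] s, of pred j] inst
  by (simp add: mass_Cons weighted_instance_def sum.lessThan_Suc_shift algebra_simps
      del: sum.lessThan_Suc)

text \<open>Dropping the prediction from the median bound leaves the share
  \<open>(1 + c) / 2\<close>.\<close>

lemma median_mechanism_side_robust:
  assumes "weighted_instance n P w" "n \<ge> 1" "0 \<le> c" "c < 1" "s \<in> {1, -1}"
  shows "(\<Sum>i<n. w ! i * side ((1 + c) / (1 - c))
    (s * (P ! i $ j - median_mechanism c P w pred $ j))) \<le> 0"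
proof -
  let ?m = "median_mechanism c P w pred $ j"
  let ?M = "mass (map (\<lambda>p. p $ j) P) w (\<lambda>x. s * (x - ?m) > 0)"
  have len: "length P = n" using assms(1) by (simp add: weighted_instance_def)
  have "0 \<le> c * (\<Sum>i<n. w ! i)"
    using weighted_instance_sum_pos[OF assms(1,2)] assms(3) by simp
  then have "?M \<le> (1 + c) * (\<Sum>i<n. w ! i) / 2"
    using median_mechanism_mass[OF assms(1-3,5), of pred j] by (simp split: if_splits)
  then have mass: "?M \<le> (1 + c) / 2 * (\<Sum>i<length (map (\<lambda>p. p $ j) P). w ! i)"
    by (simp add: len)
  have k: "0 \<le> (1 + c) / (1 - c)" "(1 + (1 + c) / (1 - c)) * ((1 + c) / 2) = (1 + c) / (1 - c)"
    using assms(3,4) by (auto simp: field_simps)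
  show ?thesis using sum_side_le_0[OF k mass] by (simp add: len)
qed

text \<open>Here the prediction lies on the bounded side, so its weight is subtracted:
  \<open>(1 + c) / 2 - c = (1 - c) / 2\<close>.\<close>

lemma median_mechanism_side_consistent:
  assumes "weighted_instance n P w" "n \<ge> 1" "0 \<le> c" "c < 1" "s \<in> {1, -1}"
    and pred: "s * (pred $ j - median_mechanism c P w pred $ j) > 0"
  shows "(\<Sum>i<n. w ! i * side ((1 - c) / (1 + c))
    (s * (P ! i $ j - median_mechanism c P w pred $ j))) \<le> 0"
proof -
  let ?m = "median_mechanism c P w pred $ j"
  let ?M = "mass (map (\<lambda>p. p $ j) P) w (\<lambda>x. s * (x - ?m) > 0)"
  have len: "length P = n" using assms(1) by (simp add: weighted_instance_def)
  have "?M \<le> (1 - c) * (\<Sum>i<n. w ! i) / 2"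
    using median_mechanism_mass[OF assms(1-3,5), of pred j] pred by (simp add: field_simps)
  then have mass: "?M \<le> (1 - c) / 2 * (\<Sum>i<length (map (\<lambda>p. p $ j) P). w ! i)"
    by (simp add: len)
  have k: "0 \<le> (1 - c) / (1 + c)" "(1 + (1 - c) / (1 + c)) * ((1 - c) / 2) = (1 - c) / (1 + c)"
    using assms(3,4) by (auto simp: field_simps)
  show ?thesis using sum_side_le_0[OF k mass] by (simp add: len)
qed

section \<open>The pointwise estimate\<close>

lemma Cauchy_Schwarz_plane:
  fixes v1 v2 q1 q2 :: real
  shows "v1 * q1 + v2 * q2 \<le> sqrt (v1\<^sup>2 + v2\<^sup>2) * sqrt (q1\<^sup>2 + q2\<^sup>2)"
proof -
  have "(v1\<^sup>2 + v2\<^sup>2) * (q1\<^sup>2 + q2\<^sup>2) - (v1 * q1 + v2 * q2)\<^sup>2 = (v1 * q2 - v2 * q1)\<^sup>2" by algebra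
  then have "(v1 * q1 + v2 * q2)\<^sup>2 \<le> (v1\<^sup>2 + v2\<^sup>2) * (q1\<^sup>2 + q2\<^sup>2)"
    by (metis diff_ge_0_iff_ge zero_le_power2)
  then show ?thesis by (simp add: real_le_rsqrt flip: real_sqrt_mult)
qed

text \<open>With N the norm, x \<le> N and y \<le> k N give N^2 = x x + y y \<le> N (x + k y); then
  divide by N.\<close>

lemma norm_le_if_small_angle:
  fixes x y k :: real
  assumes "0 \<le> x" "0 \<le> y" "y \<le> k * sqrt (x\<^sup>2 + y\<^sup>2)"
  shows "sqrt (x\<^sup>2 + y\<^sup>2) \<le> x + k * y"
proof -
  let ?N = "sqrt (x\<^sup>2 + y\<^sup>2)"
  have "x * x + y * y \<le> ?N * x + (k * ?N) * y"
    using assms by (intro add_mono mult_right_mono) (auto simp: real_le_rsqrt)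
  then have le: "?N * ?N \<le> ?N * (x + k * y)"
    by (simp add: algebra_simps power2_eq_square flip: real_sqrt_mult)
  show ?thesis
  proof (cases "x = 0 \<and> y = 0")
    case False
    then have "?N > 0" by (simp add: sum_power2_gt_zero_iff)
    with le show ?thesis by (rule mult_left_le_imp_le)
  qed simp
qed

lemma rho_ge_dist:
  fixes k q :: real
  shows "0 \<le> q \<Longrightarrow> q \<le> sqrt (1 + k\<^sup>2) * q"
  by (simp add: mult_le_cancel_right1)

text \<open>Near the x-axis the norm is at most a linear form with coefficient vector (1, -k), whose
  length is the factor. Otherwise p - (a, b) is projected onto the direction of p, and steepness
  makes \<open>b\<close> contribute at least \<open>k * b\<close>.\<close>

lemma estimate_adjacent:
  fixes a b k x y :: real
  assumes "0 \<le> a" "0 \<le> b" "0 \<le> k" "0 \<le> x" "y \<le> 0"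
  shows "sqrt (x\<^sup>2 + y\<^sup>2) \<le> sqrt (1 + k\<^sup>2) * sqrt ((x - a)\<^sup>2 + (y - b)\<^sup>2) + (a - k * b)"
proof -
  let ?N = "sqrt (x\<^sup>2 + y\<^sup>2)" and ?q = "sqrt ((x - a)\<^sup>2 + (y - b)\<^sup>2)"
  show ?thesis
  proof (cases "- y \<le> k * ?N")
    case True
    then have "?N \<le> x + k * (- y)"
      using norm_le_if_small_angle[of x "- y" k] assms by simp
    moreover have "1 * (x - a) + (- k) * (y - b) \<le> sqrt (1\<^sup>2 + (- k)\<^sup>2) * ?q"
      by (rule Cauchy_Schwarz_plane)
    ultimately show ?thesis by (simp add: algebra_simps)
  next
    case False
    have N: "?N > 0"
      using False assms by (cases "y = 0") (auto simp: sum_power2_gt_zero_iff)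
    have NN: "?N * ?N = x * x + y * y" by (simp add: power2_eq_square)
    have "x * (x - a) + y * (y - b) \<le> ?N * ?q" by (rule Cauchy_Schwarz_plane)
    moreover have "x * a \<le> ?N * a"
      using assms by (intro mult_right_mono real_le_rsqrt) auto
    moreover have "(k * ?N) * b \<le> - y * b"
      using assms False by (intro mult_right_mono) auto
    ultimately have "?N * (?N - a + k * b) \<le> ?N * ?q"
      using NN by (simp add: algebra_simps)
    then have "?N - a + k * b \<le> ?q" using N by simp
    then show ?thesis using rho_ge_dist[of ?q k] by simp
  qed
qed

text \<open>Near an axis the linear form (-1, -k) or (-k, -1) works; there k \<le> 1 absorbs the
  lost term. Away from both axes, projecting onto the direction of p gains at least k (a +
  b).\<close>

lemma estimate_opposite_small:
  fixes a b k x y :: real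
  assumes "0 \<le> a" "0 \<le> b" "0 \<le> k" "k \<le> 1" "x \<le> 0" "y \<le> 0"
  shows "sqrt (x\<^sup>2 + y\<^sup>2) + k * (a + b) \<le> sqrt (1 + k\<^sup>2) * sqrt ((x - a)\<^sup>2 + (y - b)\<^sup>2)"
proof -
  let ?N = "sqrt (x\<^sup>2 + y\<^sup>2)" and ?q = "sqrt ((x - a)\<^sup>2 + (y - b)\<^sup>2)"
  have ka: "k * a \<le> a" and kb: "k * b \<le> b" using assms by (auto simp: mult_left_le_one_le)
  consider "- y \<le> k * ?N" | "- x \<le> k * ?N" | "k * ?N < - y" "k * ?N < - x" by linarith
  then show ?thesis
  proof cases
    case 1
    then have "?N \<le> - x + k * (- y)"
      using norm_le_if_small_angle[of "- x" "- y" k] assms by simp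
    moreover have "- 1 * (x - a) + (- k) * (y - b) \<le> sqrt ((- 1)\<^sup>2 + (- k)\<^sup>2) * ?q"
      by (rule Cauchy_Schwarz_plane)
    ultimately show ?thesis using ka by (simp add: algebra_simps)
  next
    case 2
    then have "?N \<le> - y + k * (- x)"
      using norm_le_if_small_angle[of "- y" "- x" k] assms by (simp add: add.commute)
    moreover have "(- k) * (x - a) + - 1 * (y - b) \<le> sqrt ((- k)\<^sup>2 + (- 1)\<^sup>2) * ?q"
      by (rule Cauchy_Schwarz_plane)
    ultimately show ?thesis using kb by (simp add: algebra_simps)
  next
    case 3
    have "0 \<le> k * ?N" using assms by simp
    then have N: "?N > 0" using 3 by (simp add: sum_power2_gt_zero_iff)
    have NN: "?N * ?N = x * x + y * y" by (simp add: power2_eq_square)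
    have "x * (x - a) + y * (y - b) \<le> ?N * ?q" by (rule Cauchy_Schwarz_plane)
    moreover have "(k * ?N) * a \<le> - x * a" "(k * ?N) * b \<le> - y * b"
      using assms 3 by (intro mult_right_mono; linarith)+
    ultimately have "?N * (?N + k * (a + b)) \<le> ?N * ?q"
      using NN by (simp add: algebra_simps)
    then have "?N + k * (a + b) \<le> ?q" using N by simp
    then show ?thesis using rho_ge_dist[of ?q k] by simp
  qed
qed

text \<open>The angle between p and (a, b) at the origin is at least right, so the squared distance
  dominates the sum of the squared lengths; Cauchy-Schwarz with (1, k) finishes.\<close>

lemma estimate_opposite:
  fixes a b k x y :: real
  assumes "0 \<le> a" "0 \<le> b" "0 \<le> k" "x \<le> 0" "y \<le> 0"
  shows "sqrt (x\<^sup>2 + y\<^sup>2) + k * sqrt (a\<^sup>2 + b\<^sup>2)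
    \<le> sqrt (1 + k\<^sup>2) * sqrt ((x - a)\<^sup>2 + (y - b)\<^sup>2)"
proof -
  have "x * a \<le> 0" "y * b \<le> 0" using assms by (auto simp: mult_nonpos_nonneg)
  then have "x\<^sup>2 + y\<^sup>2 + (a\<^sup>2 + b\<^sup>2) \<le> (x - a)\<^sup>2 + (y - b)\<^sup>2"
    by (simp add: power2_eq_square algebra_simps)
  then have "sqrt (1 + k\<^sup>2) * sqrt (x\<^sup>2 + y\<^sup>2 + (a\<^sup>2 + b\<^sup>2))
      \<le> sqrt (1 + k\<^sup>2) * sqrt ((x - a)\<^sup>2 + (y - b)\<^sup>2)"
    by (intro mult_left_mono) auto
  then show ?thesis
    using Cauchy_Schwarz_plane[of 1 "sqrt (x\<^sup>2 + y\<^sup>2)" k "sqrt (a\<^sup>2 + b\<^sup>2)"] by simp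
qed

lemma estimate_same:
  fixes a b k x y :: real
  shows "sqrt (x\<^sup>2 + y\<^sup>2)
    \<le> sqrt (1 + k\<^sup>2) * sqrt ((x - a)\<^sup>2 + (y - b)\<^sup>2) + sqrt (a\<^sup>2 + b\<^sup>2)"
  using real_sqrt_sum_squares_triangle_ineq[of "x - a" a "y - b" b]
    rho_ge_dist[of "sqrt ((x - a)\<^sup>2 + (y - b)\<^sup>2)" k] by simp

text \<open>
  The second and fourth quadrants together require \<open>(1 - k) * (m + n) \<ge> (1 - k) * (a + b)\<close>. This
  forces \<open>m + n \<ge> a + b\<close> for \<open>k < 1\<close>, but is an upper bound on \<open>m + n\<close> for \<open>k > 1\<close>; there we take
  \<open>m + n = sqrt (a\<^sup>2 + b\<^sup>2)\<close>, the least value that the first quadrant allows.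
\<close>

lemma multipliers_exist:
  fixes a b k :: real
  assumes "0 \<le> a" "0 \<le> b" "0 \<le> k"
  shows "\<exists>m n. 0 \<le> m \<and> 0 \<le> n \<and> (k \<le> 1 \<longrightarrow> m = a \<and> n = b) \<and>
    (\<forall>x y. sqrt (x\<^sup>2 + y\<^sup>2)
      \<le> sqrt (1 + k\<^sup>2) * sqrt ((x - a)\<^sup>2 + (y - b)\<^sup>2) + (m * side k x + n * side k y))"
proof -
  let ?r = "sqrt (a\<^sup>2 + b\<^sup>2)"
  have r: "?r \<le> a + b" "a \<le> ?r" "b \<le> ?r"
    using assms by (auto intro: sqrt_sum_squares_le_sum real_le_rsqrt)
  obtain m n where mn: "0 \<le> m" "0 \<le> n" "k \<le> 1 \<longrightarrow> m = a \<and> n = b"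
    and same: "?r \<le> m + n" and adj: "a - k * b \<le> m - k * n" "b - k * a \<le> n - k * m"
    and opp: "\<And>x y. x \<le> 0 \<Longrightarrow> y \<le> 0 \<Longrightarrow> sqrt (x\<^sup>2 + y\<^sup>2) + k * (m + n)
      \<le> sqrt (1 + k\<^sup>2) * sqrt ((x - a)\<^sup>2 + (y - b)\<^sup>2)"
  proof (cases "k \<le> 1")
    case True
    show ?thesis
      using that[of a b] assms True r estimate_opposite_small[OF assms True] by simp
  next
    case False
    \<comment> \<open>These solve \<open>m + n = ?r\<close> and
      \<open>m - k * n = a - k * b\<close>, so two of the constraints hold with equality.\<close>
    define m n where "m = (k * ?r + a - k * b) / (1 + k)"
      and "n = (?r + k * b - a) / (1 + k)"
    have k: "1 + k > 0" using assms by simp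
    have mk: "(1 + k) * m = k * ?r + a - k * b" and nk: "(1 + k) * n = ?r + k * b - a"
      using k by (auto simp: m_def n_def)
    have "(1 + k) * (m + n) = (1 + k) * ?r"
      unfolding distrib_left mk nk by (simp add: algebra_simps)
    then have sum: "m + n = ?r" using k by simp
    have "k * b \<le> k * ?r" "0 \<le> k * b" using r assms by (auto intro: mult_left_mono)
    then have nonneg: "0 \<le> m" "0 \<le> n"
      unfolding m_def n_def using r assms k by (intro divide_nonneg_pos; linarith)+
    have "k * m + k * n = k * ?r" by (simp add: sum flip: distrib_left)
    then have m: "m = k * n + (a - k * b)" using mk by (simp add: algebra_simps)
    have "n - k * m = (1 - k) * ?r + (k * b - a)"
      using nk \<open>k * m + k * n = k * ?r\<close> by (simp add: algebra_simps)
    \<comment> \<open>For k > 1 the remaining adjacent quadrant reduces to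
      \<open>?r \<le> a + b\<close>.\<close>
    moreover have "(k - 1) * ?r \<le> (k - 1) * (a + b)"
      using r False by (intro mult_left_mono) auto
    ultimately have "b - k * a \<le> n - k * m" by (simp add: algebra_simps)
    then show ?thesis
      using that[of m n] nonneg False sum m estimate_opposite[OF assms] by simp
  qed
  have "sqrt (x\<^sup>2 + y\<^sup>2)
      \<le> sqrt (1 + k\<^sup>2) * sqrt ((x - a)\<^sup>2 + (y - b)\<^sup>2) + (m * side k x + n * side k y)" for x y
  proof -
    consider "x > 0" "y > 0" | "x > 0" "y \<le> 0" | "x \<le> 0" "y > 0" | "x \<le> 0" "y \<le> 0"
      by linarith
    then show ?thesis
    proof cases
      case 1
      then show ?thesis using estimate_same[of x y k a b] same by (simp add: side_def)
    next
      case 2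
      then show ?thesis
        using estimate_adjacent[OF assms, of x y] adj by (simp add: side_def mult.commute)
    next
      case 3
      then show ?thesis
        using estimate_adjacent[OF assms(2,1,3), of y x] adj
        by (simp add: side_def mult.commute add.commute)
    next
      case 4
      then show ?thesis using opp[of x y] by (simp add: side_def algebra_simps)
    qed
  qed
  then show ?thesis using mn by blast
qed

section \<open>Comparing costs\<close>

text \<open>Unlike \<open>sgn\<close> it is never 0, so multiplying by it is always a reflection,
  which brings the competing location into the closed first quadrant.\<close>

definition orient :: "real \<Rightarrow> real" where
  "orient r = (if r \<ge> 0 then 1 else - 1)"

lemma orient_simps: "orient r \<in> {1, -1}" "orient r * r = \<bar>r\<bar>" "(orient r * t)\<^sup>2 = t\<^sup>2"
  by (auto simp: orient_def)

lemma dist_plane: "dist (x :: point) y = sqrt ((y $ 1 - x $ 1)\<^sup>2 + (y $ 2 - x $ 2)\<^sup>2)"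
  by (simp add: dist_vec_def L2_set_def UNIV_2 dist_real_def power2_commute)

text \<open>Weak duality: the pointwise estimate is summed with the agents' weights, and the
  multiplier terms are nonpositive. For k \<le> 1 a coordinate shared by \<open>y\<close> and
  \<open>f\<close> has multiplier 0, which explains the premise on \<open>j\<close>.\<close>

lemma util_cost_le:
  assumes inst: "weighted_instance n P w" and k: "0 \<le> k"
    and side: "\<And>j. 1 < k \<or> y $ j \<noteq> f $ j \<Longrightarrow>
      (\<Sum>i<n. w ! i * side k (orient (y $ j - f $ j) * (P ! i $ j - f $ j))) \<le> 0"
  shows "util_cost w f P \<le> sqrt (1 + k\<^sup>2) * util_cost w y P"
proof -
  have len: "length P = n" and w: "\<And>i. i < n \<Longrightarrow> 0 < w ! i"
    using inst by (auto simp: weighted_instance_def)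
  define s where "s j = orient (y $ j - f $ j)" for j
  define h where "h i j = side k (s j * (P ! i $ j - f $ j))" for i j
  have sq: "(s j * t - \<bar>y $ j - f $ j\<bar>)\<^sup>2 = (t - (y $ j - f $ j))\<^sup>2" for j t
    by (auto simp: s_def orient_def power2_eq_square algebra_simps)
  obtain m1 m2 where nonneg: "0 \<le> m1" "0 \<le> m2"
    and m: "k \<le> 1 \<longrightarrow> m1 = \<bar>y $ 1 - f $ 1\<bar> \<and> m2 = \<bar>y $ 2 - f $ 2\<bar>"
    and est: "\<And>u v. sqrt (u\<^sup>2 + v\<^sup>2)
      \<le> sqrt (1 + k\<^sup>2) * sqrt ((u - \<bar>y $ 1 - f $ 1\<bar>)\<^sup>2 + (v - \<bar>y $ 2 - f $ 2\<bar>)\<^sup>2)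
        + (m1 * side k u + m2 * side k v)"
    using multipliers_exist[of "\<bar>y $ 1 - f $ 1\<bar>" "\<bar>y $ 2 - f $ 2\<bar>" k] k by auto
  have point: "dist f p \<le> sqrt (1 + k\<^sup>2) * dist y p
      + (m1 * side k (s 1 * (p $ 1 - f $ 1)) + m2 * side k (s 2 * (p $ 2 - f $ 2)))" for p
    using est[of "s 1 * (p $ 1 - f $ 1)" "s 2 * (p $ 2 - f $ 2)"]
    unfolding sq by (simp add: s_def orient_simps dist_plane)
  have neg: "m1 * (\<Sum>i<n. w ! i * h i 1) \<le> 0" "m2 * (\<Sum>i<n. w ! i * h i 2) \<le> 0"
    using nonneg m side[of 1] side[of 2] unfolding h_def s_def
    by (cases "k \<le> 1"; force simp: mult_le_0_iff)+
  have "(\<Sum>i<n. w ! i * dist f (P ! i))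
      \<le> (\<Sum>i<n. w ! i * (sqrt (1 + k\<^sup>2) * dist y (P ! i) + (m1 * h i 1 + m2 * h i 2)))"
    unfolding h_def using w by (intro sum_mono mult_left_mono point) (auto intro: less_imp_le)
  also have "\<dots> = sqrt (1 + k\<^sup>2) * (\<Sum>i<n. w ! i * dist y (P ! i))
      + (m1 * (\<Sum>i<n. w ! i * h i 1) + m2 * (\<Sum>i<n. w ! i * h i 2))"
    by (simp add: sum_distrib_left sum.distrib algebra_simps)
  also have "\<dots> \<le> sqrt (1 + k\<^sup>2) * (\<Sum>i<n. w ! i * dist y (P ! i))" using neg by simp
  finally show ?thesis by (simp add: util_cost_def len divide_right_mono)
qed

lemma sqrt_ratio_le:
  fixes a b l u :: real
  assumes "0 < a" "0 < l" "l \<le> u"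
  shows "sqrt (1 + (b / a)\<^sup>2) \<le> sqrt (a\<^sup>2 * l\<^sup>2 + b\<^sup>2 * u\<^sup>2) / (a * l)"
proof -
  have "sqrt (1 + (b / a)\<^sup>2) * (a * l) = sqrt ((1 + (b / a)\<^sup>2) * (a * l)\<^sup>2)"
    using assms by (simp add: real_sqrt_mult)
  also have "(1 + (b / a)\<^sup>2) * (a * l)\<^sup>2 = a\<^sup>2 * l\<^sup>2 + b\<^sup>2 * l\<^sup>2"
    using assms by (simp add: field_simps power_mult_distrib power_divide)
  also have "sqrt \<dots> \<le> sqrt (a\<^sup>2 * l\<^sup>2 + b\<^sup>2 * u\<^sup>2)"
    using assms by (intro real_sqrt_le_mono add_left_mono mult_left_mono power_mono) auto
  finally show ?thesis using assms by (simp add: pos_le_divide_eq)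
qed

lemma util_cost_nonneg:
  assumes "weighted_instance n P w"
  shows "0 \<le> util_cost w x P"
  using assms unfolding util_cost_def weighted_instance_def
  by (intro mult_nonneg_nonneg sum_nonneg) (auto intro: less_imp_le)

theorem theorem1:
  fixes c :: real
  assumes "0 \<le> c" and "c < 1"
  shows "\<exists>f :: mechanism. strategyproof f \<and>
    (\<forall>n P w opt. n \<ge> 1 \<longrightarrow> weighted_instance n P w \<longrightarrow> optimal_location w P opt \<longrightarrow>
       (let Wmin = Min (set w); Wmax = Max (set w) in
          util_cost w (f P w opt) P
            \<le> sqrt ((1 + c)\<^sup>2 * Wmin\<^sup>2 + (1 - c)\<^sup>2 * Wmax\<^sup>2) / ((1 + c) * Wmin)
                * util_cost w opt P \<and>
          (\<forall>pred. util_cost w (f P w pred) P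
            \<le> sqrt ((1 - c)\<^sup>2 * Wmin\<^sup>2 + (1 + c)\<^sup>2 * Wmax\<^sup>2) / ((1 - c) * Wmin)
                * util_cost w opt P)))"
proof (intro exI[of _ "median_mechanism c"] conjI allI impI)
  show "strategyproof (median_mechanism c)"
    using assms(1) by (rule strategyproof_median_mechanism)
next
  fix n P w opt
  assume n: "n \<ge> 1" and inst: "weighted_instance n P w"
  have "set w \<noteq> {}" using inst n by (auto simp: weighted_instance_def)
  moreover have "\<forall>v\<in>set w. 0 < v" using inst by (auto simp: weighted_instance_def in_set_conv_nth)
  ultimately have W: "0 < Min (set w)" "Min (set w) \<le> Max (set w)"
    by (auto intro: Max_ge)
  have "util_cost w (median_mechanism c P w opt) P
      \<le> sqrt (1 + ((1 - c) / (1 + c))\<^sup>2) * util_cost w opt P"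
  proof (rule util_cost_le[OF inst])
    fix j
    let ?a = "opt $ j - median_mechanism c P w opt $ j"
    assume "1 < (1 - c) / (1 + c) \<or> opt $ j \<noteq> median_mechanism c P w opt $ j"
    \<comment> \<open>Since c \<ge> 0, the ratio is at most 1, which rules out the first
      alternative.\<close>
    then have "opt $ j \<noteq> median_mechanism c P w opt $ j" using assms by (auto simp: field_simps)
    then have "orient ?a * ?a > 0" by (simp add: orient_simps)
    then show "(\<Sum>i<n. w ! i * side ((1 - c) / (1 + c))
        (orient ?a * (P ! i $ j - median_mechanism c P w opt $ j))) \<le> 0"
      by (intro median_mechanism_side_consistent[OF inst n assms] orient_simps)
  qed (use assms in simp)
  moreover have "util_cost w (median_mechanism c P w pred) P
      \<le> sqrt (1 + ((1 + c) / (1 - c))\<^sup>2) * util_cost w opt P" for pred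
    using assms
    by (intro util_cost_le[OF inst] median_mechanism_side_robust[OF inst n assms] orient_simps)
      simp
  moreover have "sqrt (1 + ((1 - c) / (1 + c))\<^sup>2) * util_cost w opt P
      \<le> sqrt ((1 + c)\<^sup>2 * (Min (set w))\<^sup>2 + (1 - c)\<^sup>2 * (Max (set w))\<^sup>2) / ((1 + c) * Min (set w))
        * util_cost w opt P"
    "sqrt (1 + ((1 + c) / (1 - c))\<^sup>2) * util_cost w opt P
      \<le> sqrt ((1 - c)\<^sup>2 * (Min (set w))\<^sup>2 + (1 + c)\<^sup>2 * (Max (set w))\<^sup>2) / ((1 - c) * Min (set w))
        * util_cost w opt P"
    using assms W by (intro mult_right_mono sqrt_ratio_le util_cost_nonneg[OF inst]; simp)+
  ultimately show "let Wmin = Min (set w); Wmax = Max (set w) in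
      util_cost w (median_mechanism c P w opt) P
        \<le> sqrt ((1 + c)\<^sup>2 * Wmin\<^sup>2 + (1 - c)\<^sup>2 * Wmax\<^sup>2) / ((1 + c) * Wmin)
            * util_cost w opt P \<and>
      (\<forall>pred. util_cost w (median_mechanism c P w pred) P
        \<le> sqrt ((1 - c)\<^sup>2 * Wmin\<^sup>2 + (1 + c)\<^sup>2 * Wmax\<^sup>2) / ((1 - c) * Wmin)
            * util_cost w opt P)"
    unfolding Let_def by (meson order_trans)
qed

end
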